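(* Let $A$ and $B$ be two quasinormal (possibly unbounded) operators in a complex Hilbert space such that $A^n=B^n$ for some $n\in\mathbb{N}$, $n\geq 2$. Then $D(A)=D(B)$.
   Context: A linear operator $T$ is quasinormal if it is closed, densely defined, and $TT^*T=T^*TT$. Products and powers carry their natural domains: $D(ST)=\{x\in D(T):Tx\in D(S)\}$. Equality of operators includes equality of domains. $D(\cdot)$ denotes the domain. *)

theory Defs
  imports "HOL-Analysis.Analysis"
begin

section \<open>Complex Hilbert spaces\<close>

text \<open>
  A complex inner product space is rendered together with its underlying real inner product
  space, whose inner product is the real part of the complex one.  Thus norm, topology and
  completeness are those of the library; positive definiteness of \<open>cinner\<close> and the relation
  to the norm are the lemmas below.  \<open>cinner\<close> is linear in the first argument.
\<close>

class complex_inner = real_inner +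
  fixes scaleC :: "complex \<Rightarrow> 'a \<Rightarrow> 'a" (infixr \<open>*\<^sub>C\<close> 75)
    and cinner :: "'a \<Rightarrow> 'a \<Rightarrow> complex"
  assumes scaleC_add_right: "c *\<^sub>C (x + y) = c *\<^sub>C x + c *\<^sub>C y"
    and scaleC_add_left: "(c + d) *\<^sub>C x = c *\<^sub>C x + d *\<^sub>C x"
    and scaleC_scaleC: "c *\<^sub>C (d *\<^sub>C x) = (c * d) *\<^sub>C x"
    and scaleC_of_real: "complex_of_real r *\<^sub>C x = r *\<^sub>R x"
    and cinner_commute: "cinner x y = cnj (cinner y x)"
    and cinner_add_left: "cinner (x + y) z = cinner x z + cinner y z"
    and cinner_scaleC_left: "cinner (c *\<^sub>C x) y = c * cinner x y"
    and Re_cinner: "Re (cinner x y) = inner x y"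

class chilbert_space = complex_inner + complete_space

lemma cinner_self: "cinner x x = complex_of_real ((norm x)\<^sup>2)"
  for x :: "'a::complex_inner"
proof (rule complex_eqI)
  show "Re (cinner x x) = Re (complex_of_real ((norm x)\<^sup>2))"
    by (simp add: Re_cinner power2_norm_eq_inner)
  have "Im (cinner x x) = - Im (cinner x x)"
    using arg_cong[OF cinner_commute[of x x], of Im] by simp
  then show "Im (cinner x x) = Im (complex_of_real ((norm x)\<^sup>2))"
    by simp
qed

lemma cinner_self_eq_zero_iff: "cinner x x = 0 \<longleftrightarrow> x = 0"
  for x :: "'a::complex_inner"
  by (simp add: cinner_self)

instantiation complex :: chilbert_space
begin

definition scaleC_complex :: "complex \<Rightarrow> complex \<Rightarrow> complex"
  where "scaleC_complex c x = c * x"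

definition cinner_complex :: "complex \<Rightarrow> complex \<Rightarrow> complex"
  where "cinner_complex x y = x * cnj y"

instance
  by standard
    (simp_all add: scaleC_complex_def cinner_complex_def algebra_simps scaleR_conv_of_real
      inner_complex_def)

end


section \<open>Unbounded operators\<close>

text \<open>
  An operator in a Hilbert space is a partial map \<open>T\<close> with domain \<open>dom T\<close>.  Equality of partial
  maps includes equality of domains, and \<open>S \<circ>\<^sub>m T\<close> has the natural domain
  \<open>{x \<in> dom T. T x \<in> dom S}\<close>.
\<close>

definition linear_operator :: "('a::complex_inner \<rightharpoonup> 'a) \<Rightarrow> bool" where
  "linear_operator T \<longleftrightarrow>
     T 0 = Some 0 \<and>
     (\<forall>x y u v. T x = Some u \<longrightarrow> T y = Some v \<longrightarrow> T (x + y) = Some (u + v)) \<and>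
     (\<forall>c x u. T x = Some u \<longrightarrow> T (c *\<^sub>C x) = Some (c *\<^sub>C u))"

definition closed_operator :: "('a::complex_inner \<rightharpoonup> 'a) \<Rightarrow> bool" where
  "closed_operator T \<longleftrightarrow> closed (Map.graph T)"

definition densely_defined :: "('a::complex_inner \<rightharpoonup> 'a) \<Rightarrow> bool" where
  "densely_defined T \<longleftrightarrow> closure (dom T) = UNIV"

text \<open>
  The vector \<open>z\<close> below is unique if \<open>T\<close> is densely defined; the adjoint is only meaningful
  in that case.
\<close>

definition op_adjoint :: "('a::complex_inner \<rightharpoonup> 'a) \<Rightarrow> ('a \<rightharpoonup> 'a)" where
  "op_adjoint T y =
     (if \<exists>z. \<forall>x u. T x = Some u \<longrightarrow> cinner u y = cinner x z
      then Some (THE z. \<forall>x u. T x = Some u \<longrightarrow> cinner u y = cinner x z)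
      else None)"

primrec op_power :: "('a \<rightharpoonup> 'a) \<Rightarrow> nat \<Rightarrow> ('a \<rightharpoonup> 'a)" where
  "op_power T 0 = Some"
| "op_power T (Suc n) = T \<circ>\<^sub>m op_power T n"

definition quasinormal :: "('a::complex_inner \<rightharpoonup> 'a) \<Rightarrow> bool" where
  "quasinormal T \<longleftrightarrow>
     linear_operator T \<and> closed_operator T \<and> densely_defined T \<and>
     T \<circ>\<^sub>m op_adjoint T \<circ>\<^sub>m T = op_adjoint T \<circ>\<^sub>m T \<circ>\<^sub>m T"

lemma op_adjoint_eq_Some_iff:
  fixes T :: "'a::complex_inner \<rightharpoonup> 'a"
  assumes "densely_defined T"
  shows "op_adjoint T y = Some z \<longleftrightarrow> (\<forall>x u. T x = Some u \<longrightarrow> cinner u y = cinner x z)"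
    (is "_ \<longleftrightarrow> ?P z")
proof -
  have uniq: "z = w" if z: "?P z" and w: "?P w" for z w
  proof -
    have dom_sub: "dom T \<subseteq> {x. inner x (z - w) = 0}"
    proof
      fix x assume "x \<in> dom T"
      then obtain u where "T x = Some u" by auto
      then have "cinner x z = cinner x w" using z w by metis
      then have "Re (cinner x z) = Re (cinner x w)" by simp
      then show "x \<in> {x. inner x (z - w) = 0}"
        by (simp add: Re_cinner inner_diff_right)
    qed
    have "closed {x. inner x (z - w) = 0}"
      by (intro closed_Collect_eq continuous_intros)
    then have "closure (dom T) \<subseteq> {x. inner x (z - w) = 0}"
      using dom_sub by (rule closure_minimal[rotated])
    then have "inner (z - w) (z - w) = 0"
      using assms unfolding densely_defined_def by blast
    then show "z = w" by simp
  qed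
  show ?thesis
  proof
    assume *: "op_adjoint T y = Some z"
    then have ex: "\<exists>z. ?P z" and eq: "(THE z. ?P z) = z"
      unfolding op_adjoint_def by (auto split: if_splits)
    from ex obtain w where w: "?P w" by blast
    have "?P (THE z. ?P z)"
      by (rule theI[of ?P, OF w]) (rule uniq[OF _ w])
    then show "?P z" unfolding eq .
  next
    assume z: "?P z"
    have "(THE z. ?P z) = z"
      by (rule the_equality[of ?P, OF z]) (rule uniq[OF _ z])
    moreover have "\<exists>z. ?P z" using z by blast
    ultimately show "op_adjoint T y = Some z"
      unfolding op_adjoint_def by presburger
  qed
qed

end

theory Submission
  imports Defs "HOL-Computational_Algebra.Fundamental_Theorem_Algebra"
begin

text \<open>
  Let \<open>P = (1 + A\<^sup>*A)\<^sup>-\<^sup>1\<close> and \<open>Q = (1 + B\<^sup>*B)\<^sup>-\<^sup>1\<close>.  Quasinormality makes \<open>A\<close> commute with \<open>P\<close>, so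
  that \<open>(A\<^sup>n)\<^sup>*A\<^sup>n\<close> maps \<open>P\<^sup>n w\<close> to \<open>(1 - P)\<^sup>n w\<close>, and likewise for \<open>B\<close>.  Symmetry of the form
  \<open>\<langle>A\<^sup>n x, A\<^sup>n y\<rangle> = \<langle>B\<^sup>n x, B\<^sup>n y\<rangle>\<close> then yields the identity \<open>Q\<^sup>n (1 - P)\<^sup>n = (1 - Q)\<^sup>n P\<^sup>n\<close> between
  bounded operators.  Since \<open>t\<close> is a continuous function of \<open>t\<^sup>n / (t\<^sup>n + (1 - t)\<^sup>n)\<close> on \<open>[0, 1]\<close>,
  polynomial approximation turns this identity into \<open>P = Q\<close>.  Finally, the range of \<open>P\<close> is a core
  for both \<open>A\<close> and \<open>B\<close>, on which the two graph norms agree.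
\<close>

section \<open>Complex scalars and the real inner product\<close>

lemma scaleC_one [simp]: "1 *\<^sub>C x = (x::'a::complex_inner)"
  using scaleC_of_real[of 1 x] by simp

lemma scaleC_zero_left [simp]: "0 *\<^sub>C x = (0::'a::complex_inner)"
  using scaleC_of_real[of 0 x] by simp

lemma scaleC_zero_right [simp]: "c *\<^sub>C (0::'a::complex_inner) = 0"
  using scaleC_add_right[of c 0 0] by simp

lemma scaleC_minus_left: "(- c) *\<^sub>C x = - (c *\<^sub>C (x::'a::complex_inner))"
  using scaleC_add_left[of c "- c" x] by (simp add: minus_unique)

lemma scaleC_minus_one: "(- 1) *\<^sub>C x = - (x::'a::complex_inner)"
  by (simp add: scaleC_minus_left)

lemma scaleC_i_i: "\<i> *\<^sub>C \<i> *\<^sub>C x = - (x::'a::complex_inner)"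
  by (simp add: scaleC_scaleC scaleC_minus_one)

lemma inner_scaleC_i_left: "inner (\<i> *\<^sub>C x) y = - inner x (\<i> *\<^sub>C (y::'a::complex_inner))"
proof -
  have "inner (\<i> *\<^sub>C x) y = Re (\<i> * cinner x y)"
    by (simp add: Re_cinner[symmetric] cinner_scaleC_left)
  moreover have "inner x (\<i> *\<^sub>C y) = Re (cnj (\<i> * cinner y x))"
    by (metis Re_cinner cinner_commute cinner_scaleC_left)
  moreover have "cinner y x = cnj (cinner x y)" by (rule cinner_commute)
  ultimately show ?thesis by simp
qed

text \<open>The imaginary part becomes a real part after multiplying by the imaginary unit. Hence
  identities for \<open>cinner\<close> can be checked with \<open>inner\<close> alone.\<close>

lemma cinner_conv_inner:
  "cinner x (y::'a::complex_inner) = Complex (inner x y) (- inner (\<i> *\<^sub>C x) y)"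
  by (simp add: complex_eq_iff Re_cinner[symmetric] cinner_scaleC_left)

lemma scaleC_eq_scaleR:
  "c *\<^sub>C x = Re c *\<^sub>R x + Im c *\<^sub>R \<i> *\<^sub>C (x::'a::complex_inner)"
proof -
  have "c = complex_of_real (Re c) + complex_of_real (Im c) * \<i>"
    by (simp add: complex_eq_iff)
  then have "c *\<^sub>C x = (complex_of_real (Re c) + complex_of_real (Im c) * \<i>) *\<^sub>C x" by simp
  then show ?thesis
    by (simp only: scaleC_add_left scaleC_of_real scaleC_scaleC[symmetric])
qed

lemma norm_scaleC: "norm (c *\<^sub>C x) = cmod c * norm (x::'a::complex_inner)"
proof -
  have "cinner (c *\<^sub>C x) (c *\<^sub>C x) = c * cnj (c * cinner x x)"
    by (metis cinner_commute cinner_scaleC_left)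
  then have "complex_of_real ((norm (c *\<^sub>C x))\<^sup>2) = complex_of_real ((cmod c * norm x)\<^sup>2)"
    by (simp add: cinner_self power_mult_distrib complex_norm_square[symmetric] flip: mult.assoc)
  then show ?thesis by (simp only: of_real_eq_iff) (simp add: power2_eq_iff_nonneg)
qed

section \<open>Polynomials of a positive contraction\<close>

text \<open>This is \<open>p(P)\<close> by Horner's scheme. Complex coefficients let
  \<open>p\<close> split into linear factors; real ones make \<open>p(P)\<close>
  selfadjoint.\<close>

definition op_poly :: "('a::complex_inner \<Rightarrow> 'a) \<Rightarrow> complex poly \<Rightarrow> 'a \<Rightarrow> 'a" where
  "op_poly P p = fold_coeffs (\<lambda>a f x. a *\<^sub>C x + P (f x)) p (\<lambda>_. 0)"

abbreviation real_poly :: "complex poly \<Rightarrow> bool" where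
  "real_poly p \<equiv> (\<forall>i. coeff p i \<in> \<real>)"

lemma real_poly_mult: "real_poly p \<Longrightarrow> real_poly q \<Longrightarrow> real_poly (p * q)"
  by (auto simp: coeff_mult intro!: sum_in_Reals Reals_mult)

lemma real_poly_power: "real_poly p \<Longrightarrow> real_poly (p ^ k)"
proof (induction k)
  case (Suc k)
  then show ?case using real_poly_mult[of p "p ^ k"] by simp
qed (simp add: coeff_1)

lemma real_poly_pCons: "real_poly (pCons a p) \<longleftrightarrow> a \<in> \<real> \<and> real_poly p"
  by (metis coeff_pCons_0 coeff_pCons_Suc not0_implies_Suc)

lemma real_poly_sum: "(\<And>k. k \<in> K \<Longrightarrow> real_poly (f k)) \<Longrightarrow> real_poly (sum f K)"
  by (auto simp: coeff_sum intro!: sum_in_Reals)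

lemma poly_real_in_Reals: "real_poly p \<Longrightarrow> poly p (complex_of_real t) \<in> \<real>"
  by (induction p) (auto simp: real_poly_pCons intro!: Reals_add Reals_mult)

text \<open>\<open>square_le\<close> packs both order bounds into one: \<open>P^2 \<le> P\<close>
  amounts to \<open>0 \<le> P \<le> 1\<close>, so [0, 1] plays the role of the spectrum
  below.\<close>

locale positive_contraction =
  fixes P :: "'a::complex_inner \<Rightarrow> 'a"
  assumes add: "P (x + y) = P x + P y"
    and scaleC: "P (c *\<^sub>C x) = c *\<^sub>C P x"
    and selfadjoint: "inner (P x) y = inner x (P y)"
    and square_le: "inner (P x) (P x) \<le> inner (P x) x"
begin

lemma zero [simp]: "P 0 = 0"
  using add[of 0 0] by simp

lemma scaleR: "P (r *\<^sub>R x) = r *\<^sub>R P x"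
  using scaleC[of "complex_of_real r" x] by (simp add: scaleC_of_real)

lemma minus: "P (- x) = - P x"
  using scaleR[of "- 1" x] by simp

lemma diff: "P (x - y) = P x - P y"
  using add[of x "- y"] by (simp add: minus)

lemma norm_le: "norm (P x) \<le> norm x"
proof (cases "P x = 0")
  case False
  have "norm (P x) * norm (P x) \<le> norm (P x) * norm x"
    using square_le[of x] norm_cauchy_schwarz[of "P x" x]
    by (simp add: dot_square_norm power2_eq_square)
  with False show ?thesis by simp
qed simp

lemma op_poly_0 [simp]: "op_poly P 0 x = 0"
  by (simp add: op_poly_def)

lemma op_poly_pCons [simp]: "op_poly P (pCons a p) x = a *\<^sub>C x + P (op_poly P p x)"
  by (cases "p = 0"; cases "a = 0") (auto simp: op_poly_def)

lemma op_poly_1 [simp]: "op_poly P 1 x = x"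
  by (simp add: one_pCons)

lemma op_poly_add: "op_poly P (p + q) x = op_poly P p x + op_poly P q x"
  by (induction p q rule: poly_induct2) (simp_all add: scaleC_add_left add)

lemma op_poly_smult: "op_poly P (smult c p) x = c *\<^sub>C op_poly P p x"
  by (induction p) (simp_all add: scaleC_add_right scaleC scaleC_scaleC)

lemma op_poly_minus: "op_poly P (- p) x = - op_poly P p x"
  using op_poly_smult[of "- 1" p x] by (simp add: scaleC_minus_one)

lemma op_poly_diff: "op_poly P (p - q) x = op_poly P p x - op_poly P q x"
  using op_poly_add[of p "- q" x] by (simp add: op_poly_minus)

lemma op_poly_mult: "op_poly P (p * q) x = op_poly P p (op_poly P q x)"
  by (induction p) (simp_all add: op_poly_add op_poly_smult)

lemma op_poly_sum: "op_poly P (sum f K) x = (\<Sum>k\<in>K. op_poly P (f k) x)"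
  by (induction K rule: infinite_finite_induct) (simp_all add: op_poly_add)

lemma op_poly_vec_add: "op_poly P p (x + y) = op_poly P p x + op_poly P p y"
  by (induction p) (simp_all add: scaleC_add_right add)

lemma op_poly_scaleR: "op_poly P p (r *\<^sub>R x) = r *\<^sub>R op_poly P p x"
  by (induction p)
    (simp_all add: scaleC_add_right add scaleC scaleC_scaleC mult.commute flip: scaleC_of_real)

lemma op_poly_vec_diff: "op_poly P p (x - y) = op_poly P p x - op_poly P p y"
  using op_poly_vec_add[of p x "- y"] op_poly_scaleR[of p "- 1" y] by simp

lemma op_poly_commute: "op_poly P p (P x) = P (op_poly P p x)"
  by (induction p) (simp_all add: add scaleC)

lemma op_poly_selfadjoint:
  assumes "real_poly p"
  shows "inner (op_poly P p x) y = inner x (op_poly P p y)"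
  using assms
proof (induction p arbitrary: x y)
  case (pCons a p)
  then have "a \<in> \<real>" "real_poly p" by (simp_all add: real_poly_pCons)
  then obtain r where "a = complex_of_real r" by (auto elim: Reals_cases)
  with pCons \<open>real_poly p\<close> show ?case
    by (simp add: inner_add_left inner_add_right scaleC_of_real selfadjoint op_poly_commute)
qed simp

section \<open>Norm bounds and positivity for polynomials of \<open>P\<close>\<close>

lemma op_poly_bounded: "\<exists>K>0. \<forall>x. norm (op_poly P p x) \<le> K * norm x"
proof (induction p)
  case 0
  then show ?case by (auto intro!: exI[of _ 1])
next
  case (pCons a p)
  then obtain K where K: "K > 0" "\<And>x. norm (op_poly P p x) \<le> K * norm x" by blast
  have "norm (op_poly P (pCons a p) x) \<le> (cmod a + K) * norm x" for x
  proof -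
    have "norm (op_poly P (pCons a p) x) \<le> norm (a *\<^sub>C x) + norm (P (op_poly P p x))"
      by (simp add: norm_triangle_ineq)
    also have "\<dots> \<le> cmod a * norm x + K * norm x"
      using norm_le[of "op_poly P p x"] K(2)[of x] by (simp add: norm_scaleC)
    finally show ?thesis by (simp add: distrib_right)
  qed
  moreover have "cmod a + K > 0" using K(1) by (simp add: add_nonneg_pos)
  ultimately show ?case by blast
qed

text \<open>For nonreal \<open>\<mu>\<close> the real and imaginary parts of the shift act
  orthogonally, which leaves at least \<open>\<bar>Im \<mu>\<bar> * norm x\<close>. For real
  \<open>\<mu>\<close> off [0, 1] the quadratic form of \<open>P - \<mu>\<close> stays away from
  zero.\<close>

lemma bounded_below_linear:
  assumes "\<not> (Im \<mu> = 0 \<and> 0 \<le> Re \<mu> \<and> Re \<mu> \<le> 1)"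
  shows "\<exists>c>0. \<forall>x. c * norm x \<le> norm (op_poly P [:- \<mu>, 1:] x)"
proof -
  have eq: "op_poly P [:- \<mu>, 1:] x = (P x - Re \<mu> *\<^sub>R x) - Im \<mu> *\<^sub>R \<i> *\<^sub>C x" for x
    using scaleC_eq_scaleR[of \<mu> x] by (simp add: scaleC_minus_left)
  show ?thesis
  proof (cases "Im \<mu> = 0")
    case False
    have "\<bar>Im \<mu>\<bar> * norm x \<le> norm (op_poly P [:- \<mu>, 1:] x)" for x
    proof (rule power2_le_imp_le)
      define g where "g = P x - Re \<mu> *\<^sub>R x"
      \<comment> \<open>\<open>P\<close> is selfadjoint and commutes with the imaginary unit, which
        acts skew-adjointly, so this number is its own negative.\<close>
      have "inner (P x) (\<i> *\<^sub>C x) = - inner (P x) (\<i> *\<^sub>C x)"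
        by (metis inner_commute inner_scaleC_i_left scaleC selfadjoint)
      moreover have "inner x (\<i> *\<^sub>C x) = 0"
        using inner_scaleC_i_left[of x x] by (simp add: inner_commute)
      ultimately have g: "inner g (\<i> *\<^sub>C x) = 0"
        unfolding g_def by (simp add: inner_diff_left)
      define h where "h = Im \<mu> *\<^sub>R \<i> *\<^sub>C x"
      have "inner g h = 0" using g by (simp add: h_def)
      then have "(norm (g - h))\<^sup>2 = (norm g)\<^sup>2 + (norm h)\<^sup>2"
        by (simp add: power2_norm_eq_inner inner_diff_left inner_diff_right inner_commute)
      then show "(\<bar>Im \<mu>\<bar> * norm x)\<^sup>2 \<le> (norm (op_poly P [:- \<mu>, 1:] x))\<^sup>2"
        unfolding eq g_def[symmetric] by (simp add: h_def norm_scaleC power_mult_distrib)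
    qed simp
    with False show ?thesis by (intro exI[of _ "\<bar>Im \<mu>\<bar>"]) auto
  next
    case True
    \<comment> \<open>The distance from \<open>\<mu>\<close>, which is real and off [0, 1] here, to
      that interval.\<close>
    define c where "c = max (- Re \<mu>) (Re \<mu> - 1)"
    have "c * norm x \<le> norm (P x - Re \<mu> *\<^sub>R x)" for x
    proof (cases "x = 0")
      case False
      have nonneg: "0 \<le> inner (P x) x"
        using square_le[of x] inner_ge_zero[of "P x"] by linarith
      have le: "inner (P x) x \<le> (norm x)\<^sup>2"
        using norm_cauchy_schwarz[of "P x" x] mult_right_mono[OF norm_le[of x], of "norm x"]
        by (simp add: power2_eq_square)
      have "c * (norm x)\<^sup>2 \<le> \<bar>inner (P x - Re \<mu> *\<^sub>R x) x\<bar>"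
        using nonneg le
        by (auto simp: c_def max_def inner_diff_left power2_norm_eq_inner algebra_simps abs_if)
      also have "\<dots> \<le> norm (P x - Re \<mu> *\<^sub>R x) * norm x"
        by (rule Cauchy_Schwarz_ineq2)
      finally show ?thesis using False by (simp add: power2_eq_square)
    qed simp
    moreover have "c > 0" using assms True by (auto simp: c_def)
    ultimately show ?thesis unfolding eq using True by auto
  qed
qed

text \<open>All complex roots of \<open>p\<close> lie off [0, 1]. Splitting them off one at a time
  multiplies the lower bounds of the linear factors; this stands in for the spectral mapping
  theorem.\<close>

lemma bounded_below_poly:
  assumes "p \<noteq> 0"
    and "\<And>t. 0 \<le> t \<Longrightarrow> t \<le> 1 \<Longrightarrow> poly p (complex_of_real t) \<noteq> 0"
  shows "\<exists>c>0. \<forall>x. c * norm x \<le> norm (op_poly P p x)"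
  using assms
proof (induction "degree p" arbitrary: p rule: less_induct)
  case less
  show ?case
  proof (cases "degree p = 0")
    case True
    then obtain a where "p = [:a:]" by (meson degree_eq_zeroE)
    with less.prems show ?thesis by (auto simp: norm_scaleC intro!: exI[of _ "cmod a"])
  next
    case False
    then have "\<not> constant (poly p)" by (simp add: constant_degree)
    then obtain \<mu> where "poly p \<mu> = 0" using fundamental_theorem_of_algebra by blast
    then obtain q where p: "p = [:- \<mu>, 1:] * q" by (auto simp: poly_eq_0_iff_dvd)
    have q: "q \<noteq> 0" using p less.prems(1) by auto
    have "degree p = Suc (degree q)" unfolding p by (subst degree_mult_eq) (use q in auto)
    moreover have "poly q (complex_of_real t) \<noteq> 0" if "0 \<le> t" "t \<le> 1" for t
      using less.prems(2)[OF that] by (auto simp: p)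
    ultimately obtain c where c: "c > 0" "\<And>x. c * norm x \<le> norm (op_poly P q x)"
      using less.hyps[of q] q by auto
    have "\<not> (Im \<mu> = 0 \<and> 0 \<le> Re \<mu> \<and> Re \<mu> \<le> 1)"
    proof
      assume *: "Im \<mu> = 0 \<and> 0 \<le> Re \<mu> \<and> Re \<mu> \<le> 1"
      then have "\<mu> = complex_of_real (Re \<mu>)" by (simp add: complex_eq_iff)
      with * less.prems(2)[of "Re \<mu>"] \<open>poly p \<mu> = 0\<close> show False by simp
    qed
    then obtain b where b: "b > 0" "\<And>x. b * norm x \<le> norm (op_poly P [:- \<mu>, 1:] x)"
      using bounded_below_linear by blast
    have "b * c * norm x \<le> norm (op_poly P p x)" for x
    proof -
      have "b * (c * norm x) \<le> b * norm (op_poly P q x)"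
        using b(1) c(2)[of x] by simp
      also have "\<dots> \<le> norm (op_poly P p x)"
        unfolding p op_poly_mult by (rule b(2))
      finally show ?thesis by (simp add: mult.assoc)
    qed
    with b(1) c(1) show ?thesis by (intro exI[of _ "b * c"]) auto
  qed
qed

text \<open>
  If the infimum \<open>l\<close> of the quadratic form of \<open>h(P)\<close> were negative, then \<open>h - l\<close> would have no
  zero in \<open>[0, 1]\<close>, so \<open>h(P) - l\<close> would be bounded below; being nonnegative, its quadratic form
  would then stay away from zero, contradicting the choice of \<open>l\<close>.
\<close>

lemma op_poly_nonneg:
  assumes h: "real_poly h"
    and nonneg: "\<And>t. 0 \<le> t \<Longrightarrow> t \<le> 1 \<Longrightarrow> 0 \<le> Re (poly h (complex_of_real t))"
  shows "0 \<le> inner (op_poly P h x) x"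
proof (rule ccontr)
  assume "\<not> 0 \<le> inner (op_poly P h x) x"
  then have neg: "inner (op_poly P h x) x < 0" by simp
  define S where "S = (\<lambda>y. inner (op_poly P h y) y / (norm y)\<^sup>2) ` {y. y \<noteq> 0}"
  define l where "l = Inf S"
  obtain K where K: "K > 0" "\<And>y. norm (op_poly P h y) \<le> K * norm y"
    using op_poly_bounded by blast
  have "- K \<le> s" if "s \<in> S" for s
  proof -
    from that obtain y where y: "y \<noteq> 0" "s = inner (op_poly P h y) y / (norm y)\<^sup>2"
      by (auto simp: S_def)
    have "\<bar>inner (op_poly P h y) y\<bar> \<le> K * norm y * norm y"
      using Cauchy_Schwarz_ineq2[of "op_poly P h y" y]
        mult_right_mono[OF K(2)[of y], of "norm y"] by simp
    then have "- K * (norm y)\<^sup>2 \<le> inner (op_poly P h y) y"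
      by (simp add: power2_eq_square abs_le_iff)
    with y show ?thesis by (simp add: pos_le_divide_eq)
  qed
  then have bdd: "bdd_below S" by (rule bdd_belowI)
  have "x \<noteq> 0" using neg by auto
  then have xS: "inner (op_poly P h x) x / (norm x)\<^sup>2 \<in> S" by (auto simp: S_def)
  then have "l \<le> inner (op_poly P h x) x / (norm x)\<^sup>2"
    unfolding l_def by (rule cInf_lower[OF _ bdd])
  also have "\<dots> < 0" using neg \<open>x \<noteq> 0\<close> by (simp add: divide_neg_pos)
  finally have l: "l < 0" .
  define g where "g = h - [:complex_of_real l:]"
  have gR: "real_poly g"
    using h by (auto simp: g_def coeff_pCons split: nat.split)
  have g_eq: "op_poly P g y = op_poly P h y - l *\<^sub>R y" for y
    by (simp add: g_def op_poly_diff scaleC_of_real)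
  have g_ge: "c * (norm y)\<^sup>2 \<le> inner (op_poly P g y) y \<longleftrightarrow>
      (l + c) * (norm y)\<^sup>2 \<le> inner (op_poly P h y) y" for y c
    by (simp add: g_eq inner_diff_left power2_norm_eq_inner algebra_simps)
  have "l * (norm y)\<^sup>2 \<le> inner (op_poly P h y) y" for y
  proof (cases "y = 0")
    case False
    then have "l \<le> inner (op_poly P h y) y / (norm y)\<^sup>2"
      unfolding l_def by (intro cInf_lower[OF _ bdd]) (auto simp: S_def)
    with False show ?thesis by (simp add: pos_le_divide_eq)
  qed simp
  then have g_nonneg: "0 \<le> inner (op_poly P g y) y" for y
    using g_ge[of 0 y] by simp
  have g_nz: "poly g (complex_of_real t) \<noteq> 0" if "0 \<le> t" "t \<le> 1" for t
  proof
    assume "poly g (complex_of_real t) = 0"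
    then have "Re (poly h (complex_of_real t)) = l" by (simp add: g_def)
    with nonneg[OF that] l show False by simp
  qed
  then have "g \<noteq> 0" using g_nz[of 0] by auto
  then obtain c where c: "c > 0" "\<And>y. c * norm y \<le> norm (op_poly P g y)"
    using bounded_below_poly g_nz by blast
  obtain L where L: "L > 0" "\<And>y. norm (op_poly P g y) \<le> L * norm y"
    using op_poly_bounded by blast
  have "(l + c\<^sup>2 / L) * (norm y)\<^sup>2 \<le> inner (op_poly P h y) y" for y
  proof -
    define z where "z = op_poly P g y"
    define w where "w = op_poly P g z"
    \<comment> \<open>Testing nonnegativity of \<open>g(P)\<close> on \<open>y - (1/L) z\<close>
      gives \<open>(norm z)^2 / L \<le> inner z y\<close>. Since \<open>norm z\<close> is at least
      \<open>c * norm y\<close>, the form has the uniform gap \<open>c^2 / L\<close>.\<close>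
    have "0 \<le> inner (op_poly P g (y - (1 / L) *\<^sub>R z)) (y - (1 / L) *\<^sub>R z)" by (rule g_nonneg)
    also have "\<dots> = inner z y - (1 / L) * inner z z - (1 / L) * inner w y + (1 / L)\<^sup>2 * inner w z"
      by (simp add: op_poly_vec_diff op_poly_scaleR z_def[symmetric] w_def[symmetric]
          inner_diff_left inner_diff_right power2_eq_square algebra_simps)
    also have "inner w y = inner z z"
      unfolding w_def z_def by (rule op_poly_selfadjoint[OF gR])
    also have "inner w z \<le> L * (norm z)\<^sup>2"
      using norm_cauchy_schwarz[of w z] mult_right_mono[OF L(2)[of z], of "norm z"]
      by (simp add: w_def power2_eq_square)
    finally have "0 \<le> inner z y - 2 * ((norm z)\<^sup>2 / L) + (1 / L)\<^sup>2 * (L * (norm z)\<^sup>2)"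
      by (simp add: mult_left_mono power2_norm_eq_inner)
    also have "(1 / L)\<^sup>2 * (L * (norm z)\<^sup>2) = (norm z)\<^sup>2 / L"
      using L(1) by (simp add: power2_eq_square)
    finally have "(norm z)\<^sup>2 / L \<le> inner z y" by simp
    moreover have "(c * norm y)\<^sup>2 \<le> (norm z)\<^sup>2"
      using c unfolding z_def by (intro power_mono) auto
    ultimately have "c\<^sup>2 / L * (norm y)\<^sup>2 \<le> inner z y"
      using L(1) by (smt (verit) divide_right_mono power_mult_distrib times_divide_eq_left)
    then show ?thesis unfolding z_def g_ge .
  qed
  then have "l + c\<^sup>2 / L \<le> s" if "s \<in> S" for s
    using that by (auto simp: S_def pos_le_divide_eq)
  then have "l + c\<^sup>2 / L \<le> l"
    unfolding l_def using xS by (intro cInf_greatest) auto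
  with c(1) L(1) show False by (simp add: field_simps)
qed

text \<open>The difference of the squared norms is the quadratic form of
  \<open>s * s - r * r\<close>, a real polynomial that is nonnegative on [0, 1].\<close>

lemma op_poly_norm_mono:
  assumes r: "real_poly r" and s: "real_poly s"
    and le: "\<And>t. 0 \<le> t \<Longrightarrow> t \<le> 1 \<Longrightarrow>
      cmod (poly r (complex_of_real t)) \<le> cmod (poly s (complex_of_real t))"
  shows "norm (op_poly P r x) \<le> norm (op_poly P s x)"
proof -
  have "0 \<le> inner (op_poly P (s * s - r * r) x) x"
  proof (rule op_poly_nonneg)
    show "real_poly (s * s - r * r)"
      using real_poly_mult[OF r r] real_poly_mult[OF s s] by simp
  next
    fix t :: real assume t: "0 \<le> t" "t \<le> 1"
    obtain a b where a: "poly r (complex_of_real t) = complex_of_real a"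
      and b: "poly s (complex_of_real t) = complex_of_real b"
      using poly_real_in_Reals[OF r, of t] poly_real_in_Reals[OF s, of t]
      by (auto elim!: Reals_cases)
    have "a * a \<le> b * b"
      using le[OF t] abs_le_square_iff[of a b] by (simp add: a b power2_eq_square)
    then show "0 \<le> Re (poly (s * s - r * r) (complex_of_real t))" by (simp add: a b)
  qed
  then have "(norm (op_poly P r x))\<^sup>2 \<le> (norm (op_poly P s x))\<^sup>2"
    by (simp add: op_poly_diff op_poly_mult inner_diff_left op_poly_selfadjoint[OF r]
        op_poly_selfadjoint[OF s] power2_norm_eq_inner)
  then show ?thesis by (rule power2_le_imp_le) simp
qed

end

section \<open>Orthogonal projection and the resolvent\<close>

text \<open>A minimising sequence for the distance converges to the foot of the perpendicular. The
  real setting suffices, and applies directly to graphs in the product space.\<close>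

lemma orthogonal_projection_exists:
  fixes S :: "'b::{real_inner,complete_space} set"
  assumes "closed S" "subspace S"
  shows "\<exists>y\<in>S. \<forall>z\<in>S. inner (x - y) z = 0"
proof -
  define d where "d = Inf (dist x ` S)"
  have bdd: "bdd_below (dist x ` S)" by (rule bdd_belowI[of _ 0]) auto
  have ne: "dist x ` S \<noteq> {}" using subspace_0[OF assms(2)] by blast
  have d_le: "d \<le> norm (x - z)" if "z \<in> S" for z
    unfolding d_def using cInf_lower[OF imageI[OF that] bdd] by (simp add: dist_norm)
  have d_nonneg: "0 \<le> d"
    unfolding d_def by (rule cInf_greatest[OF ne]) auto
  have "\<exists>y\<in>S. norm (x - y) < d + inverse (real (Suc k))" for k
    using cInf_lessD[OF ne, of "d + inverse (real (Suc k))"] by (auto simp: d_def dist_norm)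
  then obtain y where y: "\<And>k. y k \<in> S" "\<And>k. norm (x - y k) < d + inverse (real (Suc k))"
    by metis
  have lim: "(\<lambda>k. norm (x - y k)) \<longlonglongrightarrow> d"
  proof (rule tendsto_sandwich[where f = "\<lambda>_. d"])
    show "(\<lambda>k. d + inverse (real (Suc k))) \<longlonglongrightarrow> d"
      using tendsto_add[OF tendsto_const LIMSEQ_inverse_real_of_nat, of d] by simp
    show "\<forall>\<^sub>F k in sequentially. d \<le> norm (x - y k)"
      using d_le y(1) by (intro always_eventually) blast
    show "\<forall>\<^sub>F k in sequentially. norm (x - y k) \<le> d + inverse (real (Suc k))"
      using y(2) by (intro always_eventually allI less_imp_le)
  qed (rule tendsto_const)
  have par: "(norm (y j - y k))\<^sup>2 \<le> 2 * ((norm (x - y j))\<^sup>2 - d\<^sup>2) + 2 * ((norm (x - y k))\<^sup>2 - d\<^sup>2)"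
    for j k
  proof -
    \<comment> \<open>Parallelogram law: the midpoint lies in \<open>S\<close>, so its distance from
      \<open>x\<close> is at least \<open>d\<close>.\<close>
    have "(1/2) *\<^sub>R (y j + y k) \<in> S"
      using y(1) assms(2) by (simp add: subspace_add subspace_scale)
    then have "d\<^sup>2 \<le> (norm (x - (1/2) *\<^sub>R (y j + y k)))\<^sup>2"
      using d_le d_nonneg by (intro power_mono) auto
    then show ?thesis
      by (simp add: power2_norm_eq_inner inner_diff_left inner_diff_right inner_add_left
          inner_add_right inner_commute algebra_simps)
  qed
  have "Cauchy y"
  proof (rule metric_CauchyI)
    fix e :: real assume "e > 0"
    have "(\<lambda>k. (norm (x - y k))\<^sup>2 - d\<^sup>2) \<longlonglongrightarrow> d\<^sup>2 - d\<^sup>2" by (intro tendsto_intros lim)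
    then have "\<forall>\<^sub>F k in sequentially. (norm (x - y k))\<^sup>2 - d\<^sup>2 < e\<^sup>2 / 4"
      by (rule order_tendstoD) (use \<open>e > 0\<close> in simp)
    then obtain N where N: "\<And>k. k \<ge> N \<Longrightarrow> (norm (x - y k))\<^sup>2 - d\<^sup>2 < e\<^sup>2 / 4"
      by (auto simp: eventually_sequentially)
    have "dist (y j) (y k) < e" if "j \<ge> N" "k \<ge> N" for j k
    proof -
      have "(norm (y j - y k))\<^sup>2 < e\<^sup>2" using par[of j k] N[OF that(1)] N[OF that(2)] by simp
      then show ?thesis using \<open>e > 0\<close> by (simp add: dist_norm power2_less_imp_less)
    qed
    then show "\<exists>M. \<forall>m\<ge>M. \<forall>n\<ge>M. dist (y m) (y n) < e" by blast
  qed
  then obtain p where p: "y \<longlonglongrightarrow> p" using Cauchy_convergent by (auto simp: convergent_def)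
  have pS: "p \<in> S" using closed_sequentially[OF assms(1) _ p] y(1) by blast
  have np: "norm (x - p) = d"
    by (rule LIMSEQ_unique[OF _ lim]) (intro tendsto_intros p)
  have "inner (x - p) z = 0" if "z \<in> S" for z
  proof (cases "z = 0")
    case False
    \<comment> \<open>This coefficient minimises the distance from \<open>x\<close> along the line
      through \<open>p\<close> in direction \<open>z\<close>.\<close>
    define a where "a = inner (x - p) z / inner z z"
    have "p + a *\<^sub>R z \<in> S" using pS that assms(2) by (simp add: subspace_add subspace_scale)
    then have "d\<^sup>2 \<le> (norm (x - (p + a *\<^sub>R z)))\<^sup>2"
      using d_le d_nonneg by (intro power_mono) auto
    also have "\<dots> = (norm ((x - p) - a *\<^sub>R z))\<^sup>2" by (simp add: algebra_simps)
    also have "\<dots> = (norm (x - p))\<^sup>2 - 2 * a * inner (x - p) z + a\<^sup>2 * inner z z"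
    proof -
      have "(norm (e - a *\<^sub>R z))\<^sup>2 = (norm e)\<^sup>2 - 2 * a * inner e z + a\<^sup>2 * inner z z" for e
        by (simp add: power2_norm_eq_inner inner_diff_left inner_diff_right inner_commute
            power2_eq_square[of a] algebra_simps)
      then show ?thesis .
    qed
    also have "\<dots> = d\<^sup>2 - (inner (x - p) z)\<^sup>2 / inner z z"
      unfolding np using False by (simp add: a_def power2_eq_square)
    finally have "(inner (x - p) z)\<^sup>2 / inner z z \<le> 0" by simp
    moreover have "0 < inner z z" using False by simp
    ultimately have "(inner (x - p) z)\<^sup>2 \<le> 0" by (simp only: divide_le_0_iff) linarith
    then show ?thesis by simp
  qed simp
  with pS show ?thesis by blast
qed

lemma subspace_closure:
  fixes S :: "'b::real_normed_vector set"
  assumes "subspace S"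
  shows "subspace (closure S)"
proof (rule subspaceI)
  show "0 \<in> closure S" using subspace_0[OF assms] closure_subset by blast
next
  fix x y assume "x \<in> closure S" "y \<in> closure S"
  then obtain f g where "\<And>k. f k \<in> S" "f \<longlonglongrightarrow> x" "\<And>k. g k \<in> S" "g \<longlonglongrightarrow> y"
    by (auto simp: closure_sequential)
  moreover from this have "(\<lambda>k. f k + g k) \<longlonglongrightarrow> x + y" by (intro tendsto_add)
  moreover have "f k + g k \<in> S" for k using calculation assms by (simp add: subspace_add)
  ultimately show "x + y \<in> closure S" unfolding closure_sequential by fast
next
  fix c and x assume "x \<in> closure S"
  then obtain f where "\<And>k. f k \<in> S" "f \<longlonglongrightarrow> x" by (auto simp: closure_sequential)
  moreover from this have "(\<lambda>k. c *\<^sub>R f k) \<longlonglongrightarrow> c *\<^sub>R x" by (intro tendsto_intros)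
  moreover have "c *\<^sub>R f k \<in> S" for k using calculation assms by (simp add: subspace_scale)
  ultimately show "c *\<^sub>R x \<in> closure S" unfolding closure_sequential by fast
qed

section \<open>Closed densely defined operators and their resolvents\<close>

locale closed_dense_operator =
  fixes T :: "'a::chilbert_space \<rightharpoonup> 'a"
  assumes linear: "linear_operator T"
    and closed: "closed_operator T"
    and dense: "densely_defined T"
begin

lemma zero: "T 0 = Some 0"
  using linear by (simp add: linear_operator_def)

lemma add: "T x = Some u \<Longrightarrow> T y = Some v \<Longrightarrow> T (x + y) = Some (u + v)"
  using linear by (simp add: linear_operator_def)

lemma scaleC: "T x = Some u \<Longrightarrow> T (c *\<^sub>C x) = Some (c *\<^sub>C u)"
  using linear by (simp add: linear_operator_def)

lemma scaleR: "T x = Some u \<Longrightarrow> T (r *\<^sub>R x) = Some (r *\<^sub>R u)"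
  using scaleC[of x u "complex_of_real r"] by (simp add: scaleC_of_real)

lemma diff: "T x = Some u \<Longrightarrow> T y = Some v \<Longrightarrow> T (x - y) = Some (u - v)"
  using add[of x u "- y" "- v"] scaleR[of y v "- 1"] by simp

lemma subspace_graph: "subspace (Map.graph T)"
  by (auto simp: subspace_def zero_prod_def scaleR_prod_def zero add scaleR
      intro!: in_graphI dest!: in_graphD)

text \<open>The domain is closed under multiplication by the imaginary unit, so the real identity at
  all domain vectors already contains the imaginary part of the complex one.\<close>

lemma adjoint_iff:
  "op_adjoint T u = Some w \<longleftrightarrow> (\<forall>z v. T z = Some v \<longrightarrow> inner v u = inner z w)" (is "_ \<longleftrightarrow> ?R")
proof
  assume "op_adjoint T u = Some w"
  then have "\<forall>z v. T z = Some v \<longrightarrow> cinner v u = cinner z w"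
    by (simp add: op_adjoint_eq_Some_iff[OF dense])
  then show ?R by (metis Re_cinner)
next
  assume *: ?R
  have "cinner v u = cinner z w" if "T z = Some v" for z v
    using * that scaleC[OF that, of \<i>] by (simp add: cinner_conv_inner)
  then show "op_adjoint T u = Some w"
    by (simp add: op_adjoint_eq_Some_iff[OF dense])
qed

lemma adjoint_add:
  "op_adjoint T u = Some w \<Longrightarrow> op_adjoint T u' = Some w' \<Longrightarrow> op_adjoint T (u + u') = Some (w + w')"
  by (simp add: adjoint_iff inner_add_right)

lemma adjoint_scaleC: "op_adjoint T u = Some w \<Longrightarrow> op_adjoint T (c *\<^sub>C u) = Some (c *\<^sub>C w)"
proof -
  assume "op_adjoint T u = Some w"
  moreover have "cinner x (c *\<^sub>C y) = cnj c * cinner x y" for x y :: 'a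
    by (metis cinner_commute cinner_scaleC_left complex_cnj_mult)
  ultimately show ?thesis by (simp add: op_adjoint_eq_Some_iff[OF dense])
qed

lemma adjoint_diff:
  "op_adjoint T u = Some w \<Longrightarrow> op_adjoint T u' = Some w' \<Longrightarrow> op_adjoint T (u - u') = Some (w - w')"
  by (simp add: adjoint_iff inner_diff_right)

text \<open>The decomposition of \<open>(x, 0)\<close> along the graph of \<open>T\<close> and its orthogonal complement.\<close>

lemma resolvent_exists: "\<exists>y u. T y = Some u \<and> op_adjoint T u = Some (x - y)"
proof -
  obtain y u where yu: "(y, u) \<in> Map.graph T"
    and orth: "\<And>z v. (z, v) \<in> Map.graph T \<Longrightarrow> inner ((x, 0) - (y, u)) (z, v) = 0"
    using orthogonal_projection_exists[OF _ subspace_graph, of "(x, 0)"] closed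
    by (force simp: closed_operator_def)
  have "inner v u = inner z (x - y)" if "T z = Some v" for z v
    using orth[OF in_graphI[where m = T, OF that]] by (simp add: inner_commute)
  with yu show ?thesis by (auto simp: adjoint_iff dest: in_graphD)
qed

text \<open>The difference \<open>d\<close> of two solutions satisfies \<open>T*T d = - d\<close>;
  pairing with \<open>d\<close> gives \<open>(norm (T d))^2 = - (norm d)^2\<close>.\<close>

lemma resolvent_unique:
  assumes "T y = Some u" "op_adjoint T u = Some (x - y)"
    and "T y' = Some u'" "op_adjoint T u' = Some (x - y')"
  shows "y' = y"
proof -
  have "T (y' - y) = Some (u' - u)" by (rule diff) fact+
  moreover have "op_adjoint T (u' - u) = Some (y - y')"
    using adjoint_diff[OF assms(4,2)] by simp
  ultimately have "inner (u' - u) (u' - u) = inner (y' - y) (y - y')"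
    unfolding adjoint_iff by blast
  then have "inner (u' - u) (u' - u) + inner (y' - y) (y' - y) = 0"
    by (simp add: inner_diff_right algebra_simps)
  then have "inner (y' - y) (y' - y) = 0" using inner_ge_zero[of "u' - u"]
      inner_ge_zero[of "y' - y"] by linarith
  then show ?thesis by simp
qed

text \<open>\<open>resolvent\<close> is \<open>(1 + T\<^sup>*T)\<^sup>-\<^sup>1\<close> and \<open>T_resolvent\<close> is \<open>T (1 + T\<^sup>*T)\<^sup>-\<^sup>1\<close>.\<close>

definition resolvent :: "'a \<Rightarrow> 'a" where
  "resolvent x = (THE y. \<exists>u. T y = Some u \<and> op_adjoint T u = Some (x - y))"

definition T_resolvent :: "'a \<Rightarrow> 'a" where
  "T_resolvent x = the (T (resolvent x))"

lemma resolvent_eqI: "T y = Some u \<Longrightarrow> op_adjoint T u = Some (x - y) \<Longrightarrow> resolvent x = y"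
  unfolding resolvent_def by (rule the_equality) (use resolvent_unique in blast)+

lemma T_resolvent: "T (resolvent x) = Some (T_resolvent x)"
  and adjoint_T_resolvent: "op_adjoint T (T_resolvent x) = Some (x - resolvent x)"
proof -
  obtain y u where "T y = Some u" "op_adjoint T u = Some (x - y)" using resolvent_exists by blast
  moreover from this have "resolvent x = y" by (rule resolvent_eqI)
  ultimately show "T (resolvent x) = Some (T_resolvent x)"
    and "op_adjoint T (T_resolvent x) = Some (x - resolvent x)"
    by (simp_all add: T_resolvent_def)
qed

lemma inner_T_resolvent: "T z = Some v \<Longrightarrow> inner (T_resolvent x) v = inner (x - resolvent x) z"
  using adjoint_T_resolvent[of x] by (simp add: adjoint_iff inner_commute)

text \<open>The right-hand side is symmetric in \<open>x\<close> and \<open>y\<close>, which gives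
  selfadjointness; at \<open>x = y\<close> it gives \<open>square_le\<close>.\<close>

lemma inner_resolvent:
  "inner (resolvent x) y =
    inner (resolvent x) (resolvent y) + inner (T_resolvent x) (T_resolvent y)"
  using inner_T_resolvent[OF T_resolvent, of y x]
  by (simp add: inner_diff_left inner_diff_right inner_commute)

sublocale resolvent: positive_contraction resolvent
proof
  show "resolvent (x + y) = resolvent x + resolvent y" for x y
    using add[OF T_resolvent T_resolvent, of x y]
      adjoint_add[OF adjoint_T_resolvent adjoint_T_resolvent, of x y]
    by (intro resolvent_eqI) (auto simp: algebra_simps)
  show "resolvent (c *\<^sub>C x) = c *\<^sub>C resolvent x" for c x
  proof (rule resolvent_eqI)
    show "T (c *\<^sub>C resolvent x) = Some (c *\<^sub>C T_resolvent x)" by (intro scaleC T_resolvent)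
    have "c *\<^sub>C (x - resolvent x) = c *\<^sub>C x - c *\<^sub>C resolvent x"
      using scaleC_add_right[of c "x - resolvent x" "resolvent x"] by (simp add: algebra_simps)
    then show "op_adjoint T (c *\<^sub>C T_resolvent x) = Some (c *\<^sub>C x - c *\<^sub>C resolvent x)"
      using adjoint_scaleC[OF adjoint_T_resolvent] by metis
  qed
  show "inner (resolvent x) y = inner x (resolvent y)" for x y
    using inner_resolvent[of x y] inner_resolvent[of y x] by (simp add: inner_commute)
  show "inner (resolvent x) (resolvent x) \<le> inner (resolvent x) x" for x
    using inner_resolvent[of x x] inner_ge_zero[of "T_resolvent x"] by linarith
qed

lemma T_resolvent_diff: "T_resolvent (x - y) = T_resolvent x - T_resolvent y"
  using diff[OF T_resolvent T_resolvent, of x y] T_resolvent[of "x - y"]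
  by (simp add: resolvent.diff)

text \<open>The resolvent alone fixes these norms, so operators with equal resolvents have equal
  graph norms on its range.\<close>

lemma norm_T_resolvent: "(norm (T_resolvent x))\<^sup>2 = inner (x - resolvent x) (resolvent x)"
  using inner_T_resolvent[OF T_resolvent, of x x] by (simp add: power2_norm_eq_inner)

section \<open>The range of the resolvent as a core; comparison of domains\<close>

lemma subspace_resolvent_graph: "subspace (range (\<lambda>w. (resolvent w, T_resolvent w)))"
proof -
  have "linear (\<lambda>w. (resolvent w, T_resolvent w))"
  proof (rule linearI)
    fix x y and r :: real
    show "(resolvent (x + y), T_resolvent (x + y)) =
        (resolvent x, T_resolvent x) + (resolvent y, T_resolvent y)"
      using add[OF T_resolvent T_resolvent, of x y] T_resolvent[of "x + y"]
      by (simp add: resolvent.add)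
    show "(resolvent (r *\<^sub>R x), T_resolvent (r *\<^sub>R x)) = r *\<^sub>R (resolvent x, T_resolvent x)"
      using scaleR[OF T_resolvent, of r x] T_resolvent[of "r *\<^sub>R x"]
      by (simp add: resolvent.scaleR scaleR_prod_def)
  qed
  then show ?thesis using linear_subspace_image[OF _ subspace_UNIV] by blast
qed

text \<open>Pairing a graph vector \<open>(d, T d)\<close> with
  \<open>(resolvent w, T_resolvent w)\<close> gives \<open>inner w d\<close>. Hence a graph vector
  orthogonal to all of these is zero.\<close>

lemma resolvent_core:
  assumes "T z = Some v"
  shows "(z, v) \<in> closure (range (\<lambda>w. (resolvent w, T_resolvent w)))" (is "_ \<in> closure ?R")
proof -
  have "?R \<subseteq> Map.graph T" by (auto intro: in_graphI T_resolvent)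
  then have sub: "closure ?R \<subseteq> Map.graph T"
    using closed by (simp add: closure_minimal closed_operator_def)
  obtain q where q: "q \<in> closure ?R" "\<And>r. r \<in> closure ?R \<Longrightarrow> inner ((z, v) - q) r = 0"
    using orthogonal_projection_exists[of "closure ?R" "(z, v)"]
      subspace_closure[OF subspace_resolvent_graph] by auto
  obtain y u where yu: "q = (y, u)" by fastforce
  have T: "T (z - y) = Some (v - u)"
    using q(1) sub assms by (intro diff) (auto simp: yu dest: in_graphD)
  have "inner w (z - y) = 0" for w
  proof -
    have "inner (z - y) (resolvent w) + inner (v - u) (T_resolvent w) = 0"
      using q(2)[of "(resolvent w, T_resolvent w)"] closure_subset[of ?R] by (auto simp: yu)
    then show ?thesis
      using inner_T_resolvent[OF T, of w] inner_diff_left[of w "resolvent w" "z - y"]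
        inner_commute[of "z - y" "resolvent w"] inner_commute[of "v - u" "T_resolvent w"]
      by linarith
  qed
  from this[of "z - y"] have "z = y" by simp
  moreover from this T zero have "v = u" by simp
  ultimately show ?thesis using q(1) yu by simp
qed

end

text \<open>A vector of \<open>dom A\<close> is a graph limit of resolvent vectors. Their images
  under \<open>B\<close> have the same mutual distances as those under \<open>A\<close>, hence
  converge, and closedness of \<open>B\<close> applies.\<close>

lemma dom_subset_if_resolvent_eq:
  assumes "closed_dense_operator A" and "closed_dense_operator B"
    and eq: "closed_dense_operator.resolvent A = closed_dense_operator.resolvent B"
  shows "dom A \<subseteq> dom B"
proof
  interpret A: closed_dense_operator A by fact
  interpret B: closed_dense_operator B by fact
  fix z assume "z \<in> dom A"
  then obtain v where "A z = Some v" by auto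
  then obtain f where f: "\<And>k. f k \<in> range (\<lambda>w. (A.resolvent w, A.T_resolvent w))"
    and lim: "f \<longlonglongrightarrow> (z, v)"
    using A.resolvent_core[of z v] by (auto simp: closure_sequential)
  then have "\<forall>k. \<exists>w. f k = (A.resolvent w, A.T_resolvent w)" by blast
  then obtain w where "\<And>k. f k = (A.resolvent (w k), A.T_resolvent (w k))" by metis
  then have w: "f = (\<lambda>k. (A.resolvent (w k), A.T_resolvent (w k)))" by (rule ext)
  have zlim: "(\<lambda>k. B.resolvent (w k)) \<longlonglongrightarrow> z"
    using tendsto_fst[OF lim] by (simp add: w eq)
  have "Cauchy (\<lambda>k. A.T_resolvent (w k))"
    using tendsto_snd[OF lim] by (auto simp: w intro: LIMSEQ_imp_Cauchy)
  moreover have "dist (A.T_resolvent x) (A.T_resolvent y) = dist (B.T_resolvent x) (B.T_resolvent y)"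
    for x y
  proof -
    have "(norm (A.T_resolvent (x - y)))\<^sup>2 = (norm (B.T_resolvent (x - y)))\<^sup>2"
      by (simp add: A.norm_T_resolvent B.norm_T_resolvent eq)
    then show ?thesis
      by (simp add: dist_norm A.T_resolvent_diff B.T_resolvent_diff power2_eq_iff_nonneg)
  qed
  ultimately have "Cauchy (\<lambda>k. B.T_resolvent (w k))" by (simp add: Cauchy_def)
  then obtain b where "(\<lambda>k. B.T_resolvent (w k)) \<longlonglongrightarrow> b"
    using Cauchy_convergent by (auto simp: convergent_def)
  then have "(\<lambda>k. (B.resolvent (w k), B.T_resolvent (w k))) \<longlonglongrightarrow> (z, b)"
    by (intro tendsto_Pair zlim)
  then have "(z, b) \<in> Map.graph B"
    by (rule closed_sequentially[OF B.closed[unfolded closed_operator_def], rotated])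
      (auto intro: in_graphI B.T_resolvent)
  then show "z \<in> dom B" by (auto dest: in_graphD)
qed

section \<open>Powers of a quasinormal operator\<close>

locale quasinormal_operator =
  fixes T :: "'a::chilbert_space \<rightharpoonup> 'a"
  assumes quasinormal: "quasinormal T"

sublocale quasinormal_operator \<subseteq> closed_dense_operator T
  using quasinormal by unfold_locales (simp_all add: quasinormal_def)

context quasinormal_operator
begin

text \<open>For \<open>y = resolvent z\<close> the vector \<open>T*T y = z - y\<close> lies in
  \<open>dom T\<close>. Quasinormality then gives \<open>T*T (T y) = v - T y\<close>, the equation
  that characterises \<open>T y\<close> as \<open>resolvent v\<close>.\<close>

lemma T_resolvent_commute:
  assumes "T z = Some v"
  shows "T (resolvent z) = Some (resolvent v)"
proof -
  have "T (z - resolvent z) = Some (v - T_resolvent z)"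
    by (intro diff assms T_resolvent)
  then have "(T \<circ>\<^sub>m op_adjoint T \<circ>\<^sub>m T) (resolvent z) = Some (v - T_resolvent z)"
    using T_resolvent[of z] adjoint_T_resolvent[of z] by (simp add: map_comp_def)
  then have "(op_adjoint T \<circ>\<^sub>m T \<circ>\<^sub>m T) (resolvent z) = Some (v - T_resolvent z)"
    using quasinormal by (simp add: quasinormal_def)
  then obtain u where "T (T_resolvent z) = Some u" "op_adjoint T u = Some (v - T_resolvent z)"
    using T_resolvent[of z] by (auto simp: map_comp_Some_iff)
  then have "resolvent v = T_resolvent z" by (rule resolvent_eqI)
  then show ?thesis using T_resolvent[of z] by simp
qed

lemma power_diff:
  "op_power T k x = Some u \<Longrightarrow> op_power T k y = Some v \<Longrightarrow> op_power T k (x - y) = Some (u - v)"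
  by (induction k arbitrary: u v) (auto simp: map_comp_Some_iff intro: diff)

lemma power_resolvent:
  "op_power T k z = Some v \<Longrightarrow> op_power T k (resolvent z) = Some (resolvent v)"
  by (induction k arbitrary: v) (auto simp: map_comp_Some_iff intro: T_resolvent_commute)

text \<open>
  With \<open>R = (1 + T\<^sup>*T)\<^sup>-\<^sup>1\<close>: the vector \<open>R\<^sup>k w\<close> is mapped to \<open>(1 - R)\<^sup>k w\<close> by \<open>(T\<^sup>k)\<^sup>*T\<^sup>k\<close>.
\<close>

lemma power_resolvent_power:
  "\<exists>u. op_power T k (op_poly resolvent ([:0, 1:] ^ k) w) = Some u \<and>
    (\<forall>z v. op_power T k z = Some v \<longrightarrow>
      inner u v = inner (op_poly resolvent ([:1, - 1:] ^ k) w) z)"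
proof (induction k arbitrary: w)
  case 0
  show ?case by simp
next
  case (Suc k)
  let ?X = "op_poly resolvent ([:0, 1:] ^ k)" and ?Y = "op_poly resolvent ([:1, - 1:] ^ k)"
  obtain u where u: "op_power T k (?X w) = Some u" using Suc by blast
  obtain u' where u': "op_power T k (?X (w - resolvent w)) = Some u'"
    and inner_u': "\<And>z v. op_power T k z = Some v \<Longrightarrow> inner u' v = inner (?Y (w - resolvent w)) z"
    using Suc by blast
  have Xu: "op_power T k (resolvent (?X w)) = Some (resolvent u)"
    by (rule power_resolvent[OF u])
  \<comment> \<open>Both sides are the image under \<open>T^k\<close> of
    \<open>R^k (w - R w)\<close>. Since the adjoint of \<open>T\<close> sends
    \<open>T_resolvent u\<close> to \<open>u - R u\<close>, the outermost \<open>T\<close> can be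
    peeled off and the induction hypothesis applied.\<close>
  then have "u' = u - resolvent u"
    using power_diff[OF u Xu] u' by (simp add: resolvent.op_poly_vec_diff resolvent.op_poly_commute)
  moreover have "op_poly resolvent ([:1, - 1:] ^ Suc k) w = ?Y (w - resolvent w)"
    by (simp add: resolvent.op_poly_mult resolvent.op_poly_vec_diff resolvent.op_poly_commute
        scaleC_minus_one resolvent.minus del: mult_pCons_left)
  ultimately have "inner (T_resolvent u) v = inner (op_poly resolvent ([:1, - 1:] ^ Suc k) w) z"
    if "op_power T (Suc k) z = Some v" for z v
    using that inner_u' inner_T_resolvent[of _ v u] by (auto simp: map_comp_Some_iff simp del: power_Suc)
  moreover have "op_power T (Suc k) (op_poly resolvent ([:0, 1:] ^ Suc k) w) = Some (T_resolvent u)"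
    using Xu T_resolvent[of u]
    by (simp add: resolvent.op_poly_mult map_comp_Some_iff del: mult_pCons_left)
  ultimately show ?case by blast
qed

end

section \<open>Comparison of two positive contractions\<close>

text \<open>The bounds make \<open>(1 - m)(P)\<close> a contraction with constant
  \<open>1 - c\<close>. The Banach fixed point of \<open>y \<mapsto> (1 - m)(P) y + x\<close> solves
  \<open>m(P) y = x\<close>.\<close>

lemma op_poly_surj:
  fixes P :: "'a::chilbert_space \<Rightarrow> 'a"
  assumes "positive_contraction P" and m: "real_poly m"
    and c: "0 < c"
    and le: "\<And>t. 0 \<le> t \<Longrightarrow> t \<le> 1 \<Longrightarrow> c \<le> Re (poly m (complex_of_real t))"
      "\<And>t. 0 \<le> t \<Longrightarrow> t \<le> 1 \<Longrightarrow> Re (poly m (complex_of_real t)) \<le> 1"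
  shows "\<exists>w. op_poly P m w = x"
proof -
  interpret positive_contraction P by fact
  have "c \<le> 1" using le(1)[of 0] le(2)[of 0] by simp
  have bound: "norm (op_poly P (1 - m) y) \<le> (1 - c) * norm y" for y
  proof -
    have "norm (op_poly P (1 - m) y) \<le> norm (op_poly P [:complex_of_real (1 - c):] y)"
    proof (rule op_poly_norm_mono)
      fix t :: real assume t: "0 \<le> t" "t \<le> 1"
      obtain r where r: "poly m (complex_of_real t) = complex_of_real r"
        using poly_real_in_Reals[OF m, of t] by (auto elim!: Reals_cases)
      have "cmod (poly (1 - m) (complex_of_real t)) = \<bar>1 - r\<bar>"
        using norm_of_real[of "1 - r", where 'a = complex] by (simp add: r)
      moreover have "\<bar>1 - r\<bar> \<le> 1 - c" using le[OF t] by (simp add: r)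
      moreover have "cmod (poly [:complex_of_real (1 - c):] (complex_of_real t)) = 1 - c"
        using \<open>c \<le> 1\<close> norm_of_real[of "1 - c", where 'a = complex] by simp
      ultimately show "cmod (poly (1 - m) (complex_of_real t)) \<le>
          cmod (poly [:complex_of_real (1 - c):] (complex_of_real t))" by simp
    qed (use m in \<open>auto simp: coeff_pCons coeff_1 split: nat.split\<close>)
    also have "\<dots> = (1 - c) * norm y"
      using \<open>c \<le> 1\<close> scaleC_of_real[of "1 - c" y] by simp
    finally show ?thesis .
  qed
  have "\<exists>!y. op_poly P (1 - m) y + x = y"
  proof (rule banach_fix_type)
    show "\<forall>y z. dist (op_poly P (1 - m) y + x) (op_poly P (1 - m) z + x) \<le> (1 - c) * dist y z"
      using bound by (simp add: dist_norm flip: op_poly_vec_diff)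
  qed (use c \<open>c \<le> 1\<close> in auto)
  then show ?thesis by (auto simp: op_poly_diff algebra_simps)
qed

text \<open>For real polynomials this is \<open>b(Q) a(P) = a(Q) b(P)\<close>: informally,
  \<open>a / b\<close> agrees at \<open>P\<close> and \<open>Q\<close>. Each operator keeps to its
  own slot, as \<open>P\<close> and \<open>Q\<close> are not known to commute.\<close>

definition balanced ::
  "('a::complex_inner \<Rightarrow> 'a) \<Rightarrow> ('a \<Rightarrow> 'a) \<Rightarrow> complex poly \<Rightarrow> complex poly \<Rightarrow> bool" where
  "balanced P Q a b \<longleftrightarrow>
    (\<forall>x y. inner (op_poly P a x) (op_poly Q b y) = inner (op_poly P b x) (op_poly Q a y))"

locale positive_contraction_pair =
  P: positive_contraction P + Q: positive_contraction Q
  for P Q :: "'a::chilbert_space \<Rightarrow> 'a"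
begin

lemma balanced_refl: "balanced P Q a a"
  by (simp add: balanced_def)

lemma balanced_sum: "(\<And>k. k \<in> K \<Longrightarrow> balanced P Q (f k) b) \<Longrightarrow> balanced P Q (sum f K) b"
  by (simp add: balanced_def P.op_poly_sum Q.op_poly_sum inner_sum_left inner_sum_right)

lemma balanced_smult: "balanced P Q a b \<Longrightarrow> balanced P Q (smult (complex_of_real r) a) b"
  by (simp add: balanced_def P.op_poly_smult Q.op_poly_smult scaleC_of_real)

text \<open>Polynomials of one operator commute with each other, so the factors can be reordered in
  each slot and the two relations used in turn.\<close>

lemma balanced_mult:
  assumes "balanced P Q a b" "balanced P Q c d"
  shows "balanced P Q (a * c) (b * d)"
  unfolding balanced_def
proof (intro allI)
  fix x y
  have "inner (op_poly P (a * c) x) (op_poly Q (b * d) y) =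
      inner (op_poly P b (op_poly P c x)) (op_poly Q a (op_poly Q d y))"
    using assms(1) by (simp add: balanced_def P.op_poly_mult Q.op_poly_mult)
  also have "\<dots> = inner (op_poly P c (op_poly P b x)) (op_poly Q d (op_poly Q a y))"
    by (simp add: mult.commute flip: P.op_poly_mult Q.op_poly_mult)
  also have "\<dots> = inner (op_poly P (d * b) x) (op_poly Q (c * a) y)"
    using assms(2) by (simp add: balanced_def P.op_poly_mult Q.op_poly_mult)
  finally show "inner (op_poly P (a * c) x) (op_poly Q (b * d) y) =
      inner (op_poly P (b * d) x) (op_poly Q (a * c) y)"
    by (simp add: mult.commute)
qed

lemma balanced_power: "balanced P Q a b \<Longrightarrow> balanced P Q (a ^ k) (b ^ k)"
  by (induction k) (simp_all add: balanced_refl balanced_mult)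

text \<open>
  If \<open>h \<approx> X m\<close> on \<open>[0, 1]\<close> relative to \<open>m\<close> and the pair \<open>h, m\<close> is balanced, then for
  \<open>a = m(P) w\<close> and \<open>b = m(Q) v\<close> both \<open>\<langle>P a, b\<rangle>\<close> and \<open>\<langle>a, Q b\<rangle>\<close> are close to
  \<open>\<langle>h(P) w, b\<rangle> = \<langle>a, h(Q) v\<rangle>\<close>.
\<close>

lemma inner_approx:
  assumes bal: "balanced P Q h m" and h: "real_poly h" and m: "real_poly m" and "0 \<le> e"
    and le: "\<And>t. 0 \<le> t \<Longrightarrow> t \<le> 1 \<Longrightarrow>
      cmod (poly (h - [:0, 1:] * m) (complex_of_real t)) \<le> e * cmod (poly m (complex_of_real t))"
  shows "\<bar>inner (P (op_poly P m w)) (op_poly Q m v) - inner (op_poly P m w) (Q (op_poly Q m v))\<bar>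
    \<le> 2 * e * norm (op_poly P m w) * norm (op_poly Q m v)"
proof -
  define r where "r = h - [:0, 1:] * m"
  have r: "real_poly r"
    unfolding r_def using h real_poly_mult[OF _ m, of "[:0, 1:]"]
    by (auto simp: coeff_pCons split: nat.splits)
  have s: "real_poly (smult (complex_of_real e) m)" using m by simp
  have le': "cmod (poly r (complex_of_real t)) \<le>
      cmod (poly (smult (complex_of_real e) m) (complex_of_real t))" if "0 \<le> t" "t \<le> 1" for t
    using le[OF that] \<open>0 \<le> e\<close> by (simp add: r_def norm_mult del: mult_pCons_left)
  have normP: "norm (op_poly P r w) \<le> e * norm (op_poly P m w)"
    using P.op_poly_norm_mono[OF r s le', of w] \<open>0 \<le> e\<close>
    by (simp add: P.op_poly_smult scaleC_of_real)
  have normQ: "norm (op_poly Q r v) \<le> e * norm (op_poly Q m v)"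
    using Q.op_poly_norm_mono[OF r s le', of v] \<open>0 \<le> e\<close>
    by (simp add: Q.op_poly_smult scaleC_of_real)
  have rP: "op_poly P r w = op_poly P h w - P (op_poly P m w)"
    by (simp add: r_def P.op_poly_diff P.op_poly_mult del: mult_pCons_left)
  have rQ: "op_poly Q r v = op_poly Q h v - Q (op_poly Q m v)"
    by (simp add: r_def Q.op_poly_diff Q.op_poly_mult del: mult_pCons_left)
  have "inner (P (op_poly P m w)) (op_poly Q m v) - inner (op_poly P m w) (Q (op_poly Q m v)) =
      inner (op_poly P m w) (op_poly Q r v) - inner (op_poly P r w) (op_poly Q m v)"
    using bal by (simp add: rP rQ inner_diff_left inner_diff_right balanced_def)
  moreover have "\<bar>inner (op_poly P m w) (op_poly Q r v)\<bar> \<le> norm (op_poly P m w) * (e * norm (op_poly Q m v))"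
    using Cauchy_Schwarz_ineq2[of "op_poly P m w" "op_poly Q r v"]
      mult_left_mono[OF normQ, of "norm (op_poly P m w)"] by simp
  moreover have "\<bar>inner (op_poly P r w) (op_poly Q m v)\<bar> \<le> e * norm (op_poly P m w) * norm (op_poly Q m v)"
    using Cauchy_Schwarz_ineq2[of "op_poly P r w" "op_poly Q m v"]
      mult_right_mono[OF normP, of "norm (op_poly Q m v)"] by simp
  ultimately show ?thesis by (simp add: abs_le_iff algebra_simps)
qed

text \<open>
  The function \<open>s \<mapsto> s\<^sup>1\<^sup>/\<^sup>n / (s\<^sup>1\<^sup>/\<^sup>n + (1 - s)\<^sup>1\<^sup>/\<^sup>n)\<close> inverts \<open>t \<mapsto> t\<^sup>n / (t\<^sup>n + (1 - t)\<^sup>n)\<close>; its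
  Bernstein polynomials, made homogeneous in \<open>t\<^sup>n\<close> and \<open>(1 - t)\<^sup>n\<close>, are balanced against powers of
  \<open>t\<^sup>n + (1 - t)\<^sup>n\<close>.
\<close>

lemma eq_if_balanced_powers:
  assumes "0 < n" and bal: "balanced P Q ([:0, 1:] ^ n) ([:1, - 1:] ^ n)"
  shows "P = Q"
proof -
  define u v m :: "complex poly" where "u = [:0, 1:] ^ n" and "v = [:1, - 1:] ^ n" and "m = u + v"
  define \<mu> :: "real \<Rightarrow> real" where "\<mu> t = t ^ n + (1 - t) ^ n" for t
  have real: "real_poly u" "real_poly v" "real_poly m"
    unfolding u_def v_def m_def
    by (auto intro!: Reals_add real_poly_power[rule_format] simp: coeff_pCons split: nat.split)
  have poly_u: "poly u (complex_of_real t) = complex_of_real (t ^ n)"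
    and poly_v: "poly v (complex_of_real t) = complex_of_real ((1 - t) ^ n)"
    and poly_m: "poly m (complex_of_real t) = complex_of_real (\<mu> t)" for t
    by (simp_all add: u_def v_def m_def \<mu>_def)
  \<comment> \<open>One of \<open>t\<close> and \<open>1 - t\<close> is at least 1/2. These bounds
    on \<open>m\<close> feed the surjectivity argument.\<close>
  have \<mu>_ge: "(1/2) ^ n \<le> \<mu> t" and \<mu>_le: "\<mu> t \<le> 1" if "0 \<le> t" "t \<le> 1" for t
  proof -
    have "(1/2) ^ n \<le> t ^ n \<or> (1/2) ^ n \<le> (1 - t) ^ n"
      by (cases "1/2 \<le> t") (auto intro!: power_mono)
    then show "(1/2) ^ n \<le> \<mu> t"
      using that zero_le_power[of t n] zero_le_power[of "1 - t" n] unfolding \<mu>_def by linarith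
    have "t ^ n \<le> t" "(1 - t) ^ n \<le> 1 - t"
      using that \<open>0 < n\<close> power_decreasing[of 1 n t] power_decreasing[of 1 n "1 - t"] by auto
    then show "\<mu> t \<le> 1" by (simp add: \<mu>_def)
  qed
  have \<mu>_pos: "0 < \<mu> t" if "0 \<le> t" "t \<le> 1" for t
    using \<mu>_ge[OF that] by (rule less_le_trans[rotated]) simp
  \<comment> \<open>Add the trivially balanced pairs \<open>u, u\<close> and \<open>v, v\<close> to
    the given one.\<close>
  have bal_u: "balanced P Q u m" and bal_v: "balanced P Q v m"
    using bal unfolding m_def
    by (auto simp: u_def v_def balanced_def P.op_poly_add Q.op_poly_add inner_add_left inner_add_right)
  \<comment> \<open>Every vector is thus of the form \<open>m^N\<close> applied to something, so
    \<open>inner_approx\<close> reaches arbitrary \<open>a\<close> and \<open>b\<close>.\<close>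
  have surj: "\<exists>w. op_poly R (m ^ N) w = x" if R: "positive_contraction R"
    for R :: "'a \<Rightarrow> 'a" and N x
  proof (induction N arbitrary: x)
    case 0
    show ?case using positive_contraction.op_poly_1[OF R] by simp
  next
    case (Suc N)
    obtain y where "op_poly R m y = x"
      using op_poly_surj[OF R real(3), of "(1/2) ^ n" x] \<mu>_ge \<mu>_le by (auto simp: poly_m)
    with Suc[of y] show ?case by (auto simp: positive_contraction.op_poly_mult[OF R])
  qed
  define g where "g s = root n s / (root n s + root n (1 - s))" for s :: real
  have "continuous_on {0..1} g"
    unfolding g_def
  proof (intro continuous_intros ballI)
    fix s :: real assume "s \<in> {0..1}"
    then have "0 \<le> root n s" "0 \<le> root n (1 - s)" "0 < root n s \<or> 0 < root n (1 - s)"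
      using \<open>0 < n\<close> by auto
    then show "root n s + root n (1 - s) \<noteq> 0" by linarith
  qed
  have g: "g (t ^ n / \<mu> t) = t" if "0 \<le> t" "t \<le> 1" for t
  proof -
    have "1 - t ^ n / \<mu> t = (1 - t) ^ n / \<mu> t"
      using \<mu>_pos[OF that] by (simp add: \<mu>_def field_simps)
    moreover have "0 < root n (\<mu> t)" using \<mu>_pos[OF that] \<open>0 < n\<close> by simp
    ultimately show ?thesis
      using that \<open>0 < n\<close> by (simp add: g_def real_root_divide real_root_power_cancel flip: add_divide_distrib)
  qed
  have approx: "\<bar>inner (P a) b - inner a (Q b)\<bar> \<le> 2 * e * norm a * norm b" if "e > 0" for a b e
  proof -
    obtain N where N: "\<And>s. s \<in> {0..1} \<Longrightarrow> \<bar>g s - (\<Sum>k\<le>N. g (k / N) * Bernstein N k s)\<bar> < e"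
      using Bernstein_Weierstrass[OF \<open>continuous_on {0..1} g\<close> \<open>e > 0\<close>] by blast
    define h where
      "h = (\<Sum>k\<le>N. smult (complex_of_real (g (k / N) * (N choose k))) (u ^ k * v ^ (N - k)))"
    have "balanced P Q (u ^ k * v ^ (N - k)) (m ^ N)" if "k \<le> N" for k
      using balanced_mult[OF balanced_power[OF bal_u, of k] balanced_power[OF bal_v, of "N - k"]] that
      by (simp flip: power_add)
    then have bal_h: "balanced P Q h (m ^ N)"
      unfolding h_def by (intro balanced_sum balanced_smult) auto
    have real_h: "real_poly h"
      unfolding h_def
    proof (rule real_poly_sum)
      fix k
      have "real_poly (u ^ k * v ^ (N - k))"
        using real by (intro real_poly_mult real_poly_power)
      then show "real_poly (smult (complex_of_real (g (k / N) * (N choose k))) (u ^ k * v ^ (N - k)))"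
        by simp
    qed
    have le: "cmod (poly (h - [:0, 1:] * m ^ N) (complex_of_real t)) \<le>
        e * cmod (poly (m ^ N) (complex_of_real t))" if t: "0 \<le> t" "t \<le> 1" for t
    proof -
      \<comment> \<open>Each term of \<open>h\<close> has total degree \<open>N\<close> in
        \<open>u\<close> and \<open>v\<close>, so \<open>\<mu> t ^ N\<close> factors out and leaves
        the Bernstein polynomial of \<open>g\<close> at \<open>s\<close>, where
        \<open>g s = t\<close>.\<close>
      define s where "s = t ^ n / \<mu> t"
      have s: "t ^ n = s * \<mu> t" "(1 - t) ^ n = (1 - s) * \<mu> t"
        using \<mu>_pos[OF t] by (simp_all add: s_def \<mu>_def field_simps)
      have "g (k / N) * (N choose k) * ((t ^ n) ^ k * ((1 - t) ^ n) ^ (N - k)) =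
          g (k / N) * Bernstein N k s * \<mu> t ^ N" if "k \<le> N" for k
      proof -
        have "\<mu> t ^ N = \<mu> t ^ k * \<mu> t ^ (N - k)" using that by (simp flip: power_add)
        then show ?thesis by (simp only: s Bernstein_def power_mult_distrib mult_ac)
      qed
      then have sum_eq: "(\<Sum>k\<le>N. g (k / N) * (N choose k) * ((t ^ n) ^ k * ((1 - t) ^ n) ^ (N - k))) =
          (\<Sum>k\<le>N. g (k / N) * Bernstein N k s) * \<mu> t ^ N"
        unfolding sum_distrib_right by (intro sum.cong refl) (simp only: atMost_iff)
      have "poly h (complex_of_real t) = complex_of_real
          (\<Sum>k\<le>N. g (k / N) * (N choose k) * ((t ^ n) ^ k * ((1 - t) ^ n) ^ (N - k)))"
        by (simp add: h_def poly_sum poly_u poly_v)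
      then have "poly (h - [:0, 1:] * m ^ N) (complex_of_real t) =
          complex_of_real (((\<Sum>k\<le>N. g (k / N) * Bernstein N k s) - t) * \<mu> t ^ N)"
        unfolding sum_eq by (simp add: poly_m left_diff_distrib)
      then have "cmod (poly (h - [:0, 1:] * m ^ N) (complex_of_real t)) =
          \<bar>g s - (\<Sum>k\<le>N. g (k / N) * Bernstein N k s)\<bar> * \<mu> t ^ N"
        using \<mu>_pos[OF t] g[OF t]
        by (simp only: norm_of_real s_def abs_mult) (simp add: abs_minus_commute)
      also have "\<dots> \<le> e * \<mu> t ^ N"
      proof (intro mult_right_mono less_imp_le[OF N])
        show "s \<in> {0..1}"
          using t \<mu>_pos[OF t] by (auto simp: s_def \<mu>_def)
      qed (use \<mu>_pos[OF t] in simp)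
      finally show ?thesis using \<mu>_pos[OF t] by (simp add: poly_m norm_power)
    qed
    obtain w where w: "op_poly P (m ^ N) w = a"
      using surj[OF P.positive_contraction_axioms] by blast
    obtain v where v: "op_poly Q (m ^ N) v = b"
      using surj[OF Q.positive_contraction_axioms] by blast
    show ?thesis
      using inner_approx[OF bal_h real_h real_poly_power[OF real(3)] less_imp_le[OF that] le, of w v]
      by (simp add: w v)
  qed
  have "inner (P a) b = inner a (Q b)" for a b
  proof -
    have "\<bar>inner (P a) b - inner a (Q b)\<bar> \<le> 0 + e" if "e > 0" for e
    proof -
      \<comment> \<open>The added 1 keeps the denominator positive when \<open>a\<close> or
        \<open>b\<close> is zero.\<close>
      define d where "d = e / (2 * norm a * norm b + 1)"
      have "d > 0" using that by (simp add: d_def add_nonneg_pos)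
      have "\<bar>inner (P a) b - inner a (Q b)\<bar> \<le> d * (2 * norm a * norm b)"
        using approx[OF \<open>d > 0\<close>, of a b] by (simp add: ac_simps)
      also have "\<dots> \<le> d * (2 * norm a * norm b + 1)" using \<open>d > 0\<close> by simp
      also have "\<dots> = e" using add_nonneg_pos[of "2 * norm a * norm b" 1] by (simp add: d_def)
      finally show ?thesis by simp
    qed
    then have "\<bar>inner (P a) b - inner a (Q b)\<bar> \<le> 0" by (rule field_le_epsilon)
    then show ?thesis by simp
  qed
  then have "inner (P a - Q a) (P a - Q a) = 0" for a
    using Q.selfadjoint[of a] by (simp add: inner_diff_left)
  then show ?thesis by (intro ext) simp
qed

end

section \<open>From equal powers to equal resolvents and equal domains\<close>

theorem proposition5p12:
  fixes A B :: "'a::chilbert_space \<rightharpoonup> 'a" and n :: nat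
  assumes "quasinormal A" and "quasinormal B"
    and "n \<ge> 2"
    and "op_power A n = op_power B n"
  shows "dom A = dom B"
proof -
  interpret A: quasinormal_operator A by unfold_locales fact
  interpret B: quasinormal_operator B by unfold_locales fact
  interpret positive_contraction_pair A.resolvent B.resolvent by unfold_locales
  have "balanced A.resolvent B.resolvent ([:0, 1:] ^ n) ([:1, - 1:] ^ n)"
    unfolding balanced_def
  proof (intro allI)
    fix x y
    obtain u where u: "op_power A n (op_poly A.resolvent ([:0, 1:] ^ n) x) = Some u"
      "\<And>z v. op_power A n z = Some v \<Longrightarrow>
        inner u v = inner (op_poly A.resolvent ([:1, - 1:] ^ n) x) z"
      using A.power_resolvent_power by blast
    obtain v where v: "op_power B n (op_poly B.resolvent ([:0, 1:] ^ n) y) = Some v"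
      "\<And>z u. op_power B n z = Some u \<Longrightarrow>
        inner v u = inner (op_poly B.resolvent ([:1, - 1:] ^ n) y) z"
      using B.power_resolvent_power by blast
    \<comment> \<open>As the powers agree, \<open>inner u v\<close> can be evaluated by both facts:
      moving \<open>A^n\<close> off \<open>u\<close> gives the right-hand side, moving
      \<open>B^n\<close> off \<open>v\<close> the left.\<close>
    show "inner (op_poly A.resolvent ([:0, 1:] ^ n) x) (op_poly B.resolvent ([:1, - 1:] ^ n) y) =
        inner (op_poly A.resolvent ([:1, - 1:] ^ n) x) (op_poly B.resolvent ([:0, 1:] ^ n) y)"
      using u(2) v(2) u(1) v(1) assms(4) by (metis inner_commute)
  qed
  then have "A.resolvent = B.resolvent"
    using assms(3) by (intro eq_if_balanced_powers[of n]) simp_all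
  then show ?thesis
    using dom_subset_if_resolvent_eq[of A B] dom_subset_if_resolvent_eq[of B A]
      A.closed_dense_operator_axioms B.closed_dense_operator_axioms by simp
qed

end
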